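(* Let $f(x)$ be a real-valued function on $\mathbb{R}$ such that $|f(x)|$ grows at most of polynomial order in $|x|$ as $x\to\pm\infty$. Let $$h(x;\alpha)=E[f(x+\sqrt\alpha\,\xi)]=\int_{-\infty}^\infty f(t)\,\phi\Bigl(\frac{t-x}{\sqrt\alpha}\Bigr)\frac{dt}{\sqrt\alpha},\qquad x\in\mathbb{R},\ \alpha>0,$$ where $\xi\sim\mathcal N(0,1)$ and $\phi(x)=\frac{1}{\sqrt{2\pi}}e^{-x^2/2}$ is the density function of $\mathcal N(0,1)$. Then: 1. For each $\alpha>0$, $h(\cdot;\alpha)$ extends to an entire function $h(z;\alpha)$, $z\in\mathbb{C}$. 2. For $\alpha,\beta>0$, it holds that $h(z;\alpha+\beta)=E[h(z+\sqrt\beta\,\xi;\alpha)]$ for all $z\in\mathbb{C}$. 3. Moreover, for $\alpha,\beta>0$, $h(z;\alpha)=E[h(z+\sqrt{-1}\sqrt\beta\,\xi;\alpha+\beta)]$ holds for all $z\in\mathbb{C}$.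
   Context: $\mathcal N(0,1)$ is the standard Gaussian distribution on $\mathbb{R}$, $\xi$ is a standard Gaussian random variable, and $E$ denotes expectation with respect to $\xi$. In items 2 and 3, $h$ denotes the entire extension from item 1. *)

theory Defs
  imports "HOL-Probability.Probability" "HOL-Complex_Analysis.Complex_Analysis"
begin

text \<open>
  \<open>O[at_infinity]\<close> on the reals covers both \<open>x \<rightarrow> \<infinity>\<close> and \<open>x \<rightarrow> -\<infinity>\<close>; it says nothing about
  bounded sets.
\<close>

definition polynomial_growth :: "(real \<Rightarrow> real) \<Rightarrow> bool" where
  "polynomial_growth f \<longleftrightarrow> (\<exists>k::nat. f \<in> O[at_infinity](\<lambda>x. \<bar>x\<bar> ^ k))"

definition locally_integrable :: "(real \<Rightarrow> real) \<Rightarrow> bool" where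
  "locally_integrable f \<longleftrightarrow> (\<forall>a b. set_integrable lborel {a..b} f)"

definition gaussian_smoothing ::
  "'w measure \<Rightarrow> ('w \<Rightarrow> real) \<Rightarrow> (real \<Rightarrow> real) \<Rightarrow> real \<Rightarrow> real \<Rightarrow> real" where
  "gaussian_smoothing M \<xi> f x \<alpha> = (\<integral>\<omega>. f (x + sqrt \<alpha> * \<xi> \<omega>) \<partial>M)"

text \<open>
  By the identity theorem a function on the reals has at most one entire extension, so a
  statement about every \<open>H\<close> with \<open>entire_extension g H\<close> is one about the extension of \<open>g\<close>.
\<close>

definition entire_extension :: "(real \<Rightarrow> real) \<Rightarrow> (complex \<Rightarrow> complex) \<Rightarrow> bool" where
  "entire_extension g H \<longleftrightarrow>
     H holomorphic_on UNIV \<and> (\<forall>x. H (complex_of_real x) = complex_of_real (g x))"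

end

theory Submission
  imports Defs
begin

text \<open>
  Write \<open>p\<^sub>\<alpha>(w) = exp (- w\<^sup>2 / (2\<alpha>)) / sqrt (2\<pi>\<alpha>)\<close> for the heat kernel at a complex point \<open>w\<close>. On the
  real line \<open>h(x; \<alpha>) = \<integral> f(t) p\<^sub>\<alpha>(t - x) dt\<close>, so the entire extension has to be
  \<open>\<integral> f(t) p\<^sub>\<alpha>(t - z) dt\<close>. This integral does define an entire function: expanding the square
  in the exponent turns it into \<open>p\<^sub>\<alpha>(z)\<close> times the two-sided Laplace transform, at \<open>z / \<alpha>\<close>, of
  \<open>f(t) exp (- t\<^sup>2 / (2\<alpha>))\<close>, which decays fast enough for that transform to be a power series
  with infinite radius of convergence. Two entire functions that agree on the real line are
  equal, so every other extension of \<open>h(\<cdot>; \<alpha>)\<close> is this one.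

  Both averaging identities are instances of a single one. Let \<open>\<sigma>\<close> be a complex number whose
  square is a real number \<open>\<tau>\<close> with \<open>\<alpha> + \<tau> > 0\<close>. Then \<open>E p\<^sub>\<alpha>(w - \<sigma>\<xi>) = p\<^sub>\<alpha>\<^sub>+\<^sub>\<tau>(w)\<close>
  (\<open>gaussian_average_heat_kernel\<close>): the exponent is quadratic in the variable of integration with
  a negative real leading coefficient, so after rescaling the claim is the formula
  \<open>E exp (b\<xi>) = exp (b\<^sup>2 / 2)\<close> for complex \<open>b\<close>. Integrating against \<open>f\<close> and exchanging the two
  integrals gives \<open>h(z; \<alpha> + \<tau>) = E h(z + \<sigma>\<xi>; \<alpha>)\<close> (\<open>heat_extension_semigroup\<close>). The choice
  \<open>\<sigma> = sqrt \<beta>\<close>, \<open>\<tau> = \<beta>\<close> is the forward identity; \<open>\<sigma> = \<i> sqrt \<beta>\<close>, \<open>\<tau> = - \<beta>\<close>, with \<open>\<alpha> + \<beta>\<close> in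
  place of \<open>\<alpha>\<close>, is the backward one.

  The exchange of integrals needs joint integrability in \<open>(t, s)\<close>. It rests on
  \<open>heat_kernel_gaussian_bound\<close>: as long as \<open>(Im \<sigma>)\<^sup>2 < \<alpha>\<close>, the Gaussian weight of \<open>\<xi>\<close> beats the
  growth of \<open>p\<^sub>\<alpha>\<close> in imaginary directions and still leaves Gaussian decay in both variables.
\<close>

section \<open>Functions integrable against every Gaussian weight\<close>

text \<open>
  The only consequence of polynomial growth and local integrability that enters the argument.
  Since every \<open>\<epsilon> > 0\<close> is admitted, one half of a given weight suffices for integrability and the
  other half can absorb exponential factors.
\<close>

definition gaussian_integrable :: "(real \<Rightarrow> real) \<Rightarrow> bool" where
  "gaussian_integrable f \<longleftrightarrow> f \<in> borel_measurable borel \<and>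
     (\<forall>\<epsilon>>0. integrable lborel (\<lambda>t. f t * exp (- (\<epsilon> * t\<^sup>2))))"

lemma integrable_power_exp_square:
  assumes "0 < (\<epsilon>::real)"
  shows "integrable lborel (\<lambda>t::real. \<bar>t\<bar> ^ k * exp (- (\<epsilon> * t\<^sup>2)))"
proof -
  define \<sigma> where "\<sigma> = 1 / sqrt (2 * \<epsilon>)"
  have s2: "\<sigma>\<^sup>2 = 1 / (2 * \<epsilon>)" and s: "\<sigma> > 0"
    using assms by (simp_all add: \<sigma>_def power_divide)
  have "integrable lborel (\<lambda>t. sqrt (2 * pi * \<sigma>\<^sup>2) * (normal_density 0 \<sigma> t * \<bar>t - 0\<bar> ^ k))"
    by (intro integrable_mult_right integrable_normal_moment_abs s)
  also have "(\<lambda>t. sqrt (2 * pi * \<sigma>\<^sup>2) * (normal_density 0 \<sigma> t * \<bar>t - 0\<bar> ^ k)) =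
      (\<lambda>t. \<bar>t\<bar> ^ k * exp (- (\<epsilon> * t\<^sup>2)))"
    using assms by (simp add: fun_eq_iff normal_density_def s2)
  finally show ?thesis .
qed

text \<open>
  Local integrability controls a compact interval, outside of which the growth bound makes the
  integrand a Gaussian moment.
\<close>

lemma polynomial_growth_gaussian_integrable:
  assumes meas[measurable]: "f \<in> borel_measurable borel"
    and loc: "locally_integrable f" and growth: "polynomial_growth f"
  shows "gaussian_integrable f"
  unfolding gaussian_integrable_def
proof (intro conjI allI impI)
  show "f \<in> borel_measurable borel" by fact
  fix \<epsilon> :: real assume eps: "0 < \<epsilon>"
  obtain k where "f \<in> O[at_infinity](\<lambda>x. \<bar>x\<bar> ^ k)"
    using growth by (auto simp: polynomial_growth_def)
  then obtain c where c: "c > 0" "eventually (\<lambda>x. norm (f x) \<le> c * norm (\<bar>x\<bar> ^ k)) at_infinity"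
    by (auto elim: landau_o.bigE)
  then obtain b where b: "\<And>x. b \<le> norm x \<Longrightarrow> norm (f x) \<le> c * norm (\<bar>x\<bar> ^ k)"
    by (auto simp: eventually_at_infinity)
  have "integrable lborel (\<lambda>t. \<bar>indicator {-b..b} t *\<^sub>R f t\<bar> + c * (\<bar>t\<bar> ^ k * exp (- (\<epsilon> * t\<^sup>2))))"
    using loc[unfolded locally_integrable_def set_integrable_def] eps
    by (intro Bochner_Integration.integrable_add integrable_abs integrable_mult_right
        integrable_power_exp_square) auto
  then show "integrable lborel (\<lambda>t. f t * exp (- (\<epsilon> * t\<^sup>2)))"
  proof (rule Bochner_Integration.integrable_bound)
    show "AE t in lborel. norm (f t * exp (- (\<epsilon> * t\<^sup>2))) \<le>
      norm (\<bar>indicator {-b..b} t *\<^sub>R f t\<bar> + c * (\<bar>t\<bar> ^ k * exp (- (\<epsilon> * t\<^sup>2))))"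
    proof (intro always_eventually allI)
      fix t
      have e1: "exp (- (\<epsilon> * t\<^sup>2)) \<le> 1" using eps by simp
      have nn: "0 \<le> c * (\<bar>t\<bar> ^ k * exp (- (\<epsilon> * t\<^sup>2)))" using c by simp
      show "norm (f t * exp (- (\<epsilon> * t\<^sup>2))) \<le>
        norm (\<bar>indicator {-b..b} t *\<^sub>R f t\<bar> + c * (\<bar>t\<bar> ^ k * exp (- (\<epsilon> * t\<^sup>2))))"
      proof (cases "b \<le> \<bar>t\<bar>")
        case True
        then have "\<bar>f t\<bar> * exp (- (\<epsilon> * t\<^sup>2)) \<le> (c * \<bar>t\<bar> ^ k) * exp (- (\<epsilon> * t\<^sup>2))"
          using b[of t] by (intro mult_right_mono) auto
        then show ?thesis
          using nn by (simp add: abs_mult mult.assoc add_increasing)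
      next
        case False
        then have t: "t \<in> {-b..b}" by auto
        have "\<bar>f t\<bar> * exp (- (\<epsilon> * t\<^sup>2)) \<le> \<bar>f t\<bar>"
          using e1 by (simp add: mult_left_le)
        then show ?thesis using t nn by (simp add: abs_mult)
      qed
    qed
  qed measurable
qed

text \<open>Used to trade a linear exponent for an arbitrarily small part of a Gaussian one.\<close>

lemma linear_le_square:
  fixes b u \<epsilon> :: real
  assumes "0 < \<epsilon>"
  shows "b * u \<le> \<epsilon> * u\<^sup>2 + b\<^sup>2 / (4 * \<epsilon>)"
proof -
  have "0 \<le> (2 * \<epsilon> * u - b)\<^sup>2 / (4 * \<epsilon>)" using assms by simp
  also have "\<dots> = \<epsilon> * u\<^sup>2 + b\<^sup>2 / (4 * \<epsilon>) - b * u"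
    using assms by (simp add: field_simps power2_eq_square)
  finally show ?thesis by simp
qed

lemma gaussian_integrable_exp_abs:
  assumes f: "gaussian_integrable f" and eps: "0 < \<epsilon>"
  shows "integrable lborel (\<lambda>t. f t * exp (- (\<epsilon> * t\<^sup>2)) * exp (b * \<bar>t\<bar>))"
proof -
  have [measurable]: "f \<in> borel_measurable borel" using f by (simp add: gaussian_integrable_def)
  have "integrable lborel (\<lambda>t. exp (b\<^sup>2 / (2 * \<epsilon>)) * (f t * exp (- ((\<epsilon> / 2) * t\<^sup>2))))"
    by (intro integrable_mult_right f[unfolded gaussian_integrable_def, THEN conjunct2, rule_format])
      (use eps in simp)
  then show ?thesis
  proof (rule Bochner_Integration.integrable_bound)
    show "AE t in lborel. norm (f t * exp (- (\<epsilon> * t\<^sup>2)) * exp (b * \<bar>t\<bar>)) \<le>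
       norm (exp (b\<^sup>2 / (2 * \<epsilon>)) * (f t * exp (- ((\<epsilon> / 2) * t\<^sup>2))))"
    proof (intro always_eventually allI)
      fix t
      have "exp (- (\<epsilon> * t\<^sup>2)) * exp (b * \<bar>t\<bar>) \<le> exp (b\<^sup>2 / (2 * \<epsilon>)) * exp (- ((\<epsilon> / 2) * t\<^sup>2))"
        using linear_le_square[of "\<epsilon> / 2" b "\<bar>t\<bar>"] eps by (simp flip: exp_add)
      then have "\<bar>f t\<bar> * (exp (- (\<epsilon> * t\<^sup>2)) * exp (b * \<bar>t\<bar>)) \<le>
          \<bar>f t\<bar> * (exp (b\<^sup>2 / (2 * \<epsilon>)) * exp (- ((\<epsilon> / 2) * t\<^sup>2)))"
        by (intro mult_left_mono) auto
      then show "norm (f t * exp (- (\<epsilon> * t\<^sup>2)) * exp (b * \<bar>t\<bar>)) \<le>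
          norm (exp (b\<^sup>2 / (2 * \<epsilon>)) * (f t * exp (- ((\<epsilon> / 2) * t\<^sup>2))))"
        by (simp add: abs_mult mult_ac)
    qed
  qed measurable
qed

section \<open>The heat kernel and the entire extension\<close>

text \<open>
  Expanding the exponential gives the power series with coefficients \<open>\<integral> g(t) t\<^sup>n / n! dt\<close>. Its
  terms may be integrated one by one since their absolute values add up to
  \<open>\<bar>g t\<bar> exp (\<bar>z\<bar> \<bar>t\<bar>)\<close>, which is integrable for every \<open>z\<close>.
\<close>

lemma laplace_transform_entire:
  fixes g :: "real \<Rightarrow> real"
  assumes [measurable]: "g \<in> borel_measurable borel"
    and int: "\<And>b. integrable lborel (\<lambda>t. g t * exp (b * \<bar>t\<bar>))"
  shows "(\<lambda>z. \<integral>t. complex_of_real (g t) * exp (z * of_real t) \<partial>lborel) holomorphic_on UNIV"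
proof -
  define F where "F = (\<lambda>z. \<integral>t. complex_of_real (g t) * exp (z * of_real t) \<partial>lborel)"
  define a where "a n = (\<integral>t. complex_of_real (g t * t ^ n / fact n) \<partial>lborel)" for n :: nat
  have sums: "(\<lambda>n. a n * z ^ n) sums F z" for z
  proof -
    define u where "u n t = complex_of_real (g t * t ^ n / fact n) * z ^ n" for n :: nat and t :: real
    have [measurable]: "u n \<in> borel_measurable borel" for n
      unfolding u_def by measurable
    have nu: "norm (u n t) = \<bar>g t\<bar> * ((norm z * \<bar>t\<bar>) ^ n / fact n)" for n t
      by (simp add: u_def norm_mult norm_divide norm_power power_mult_distrib abs_mult power_abs)
    have ds: "(\<lambda>n. norm (u n t)) sums (\<bar>g t\<bar> * exp (norm z * \<bar>t\<bar>))" for t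
      unfolding nu using exp_converges[of "norm z * \<bar>t\<bar>"]
      by (intro sums_mult) (simp add: field_simps)
    have part: "(\<Sum>n<N. norm (u n t)) \<le> \<bar>g t\<bar> * exp (norm z * \<bar>t\<bar>)" for N :: nat and t
      using sum_le_suminf[OF sums_summable[OF ds[of t]], of "{..<N}"] sums_unique[OF ds[of t]]
      by simp
    have dom: "integrable lborel (\<lambda>t. \<bar>g t\<bar> * exp (norm z * \<bar>t\<bar>))"
      using integrable_abs[OF int[of "norm z"]] by (simp add: abs_mult)
    have ui: "integrable lborel (u n)" for n
    proof (rule Bochner_Integration.integrable_bound[OF dom])
      have "norm (u n t) \<le> \<bar>g t\<bar> * exp (norm z * \<bar>t\<bar>)" for t
      proof -
        have "norm (u n t) \<le> (\<Sum>i<Suc n. norm (u i t))"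
          by (rule member_le_sum) auto
        then show ?thesis using part[of t "Suc n"] by linarith
      qed
      then show "AE t in lborel. norm (u n t) \<le> norm (\<bar>g t\<bar> * exp (norm z * \<bar>t\<bar>))"
        by (simp add: abs_mult)
    qed measurable
    have "(\<lambda>n. integral\<^sup>L lborel (u n)) sums (\<integral>t. (\<Sum>n. u n t) \<partial>lborel)"
    proof (rule sums_integral)
      show "summable (\<lambda>n. \<integral>t. norm (u n t) \<partial>lborel)"
      proof (rule summableI_nonneg_bounded)
        show "(\<Sum>n<N. \<integral>t. norm (u n t) \<partial>lborel) \<le> (\<integral>t. \<bar>g t\<bar> * exp (norm z * \<bar>t\<bar>) \<partial>lborel)" for N
        proof -
          have "(\<Sum>n<N. \<integral>t. norm (u n t) \<partial>lborel) = (\<integral>t. (\<Sum>n<N. norm (u n t)) \<partial>lborel)"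
            by (rule Bochner_Integration.integral_sum[symmetric]) (rule integrable_norm[OF ui])
          also have "\<dots> \<le> (\<integral>t. \<bar>g t\<bar> * exp (norm z * \<bar>t\<bar>) \<partial>lborel)"
            by (intro integral_mono Bochner_Integration.integrable_sum integrable_norm ui dom part)
          finally show ?thesis .
        qed
      qed simp
    qed (use ui sums_summable[OF ds] in auto)
    moreover have "(\<Sum>n. u n t) = of_real (g t) * exp (z * of_real t)" for t
    proof -
      have "(\<lambda>n. of_real (g t) * ((z * of_real t) ^ n /\<^sub>R fact n)) sums (of_real (g t) * exp (z * of_real t))"
        by (intro sums_mult exp_converges)
      moreover have "(\<lambda>n. of_real (g t) * ((z * of_real t) ^ n /\<^sub>R fact n)) = (\<lambda>n. u n t)"
        by (simp add: u_def fun_eq_iff scaleR_conv_of_real field_simps)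
      ultimately show ?thesis by (simp add: sums_iff)
    qed
    moreover have "integral\<^sup>L lborel (u n) = a n * z ^ n" for n
      unfolding u_def a_def by simp
    ultimately show ?thesis by (simp add: F_def)
  qed
  have "F holomorphic_on ball 0 r" for r
    by (rule power_series_holomorphic[where a = a]) (use sums in simp)
  then have "F field_differentiable at z" for z
    by (rule holomorphic_on_imp_differentiable_at[where s = "ball 0 (norm z + 1)"]) auto
  then show ?thesis
    unfolding F_def[symmetric] by (simp add: holomorphic_on_def field_differentiable_at_within)
qed

lemma entire_eqI_real:
  assumes "H holomorphic_on UNIV" "K holomorphic_on UNIV"
    and eq: "\<And>x::real. H (of_real x) = K (of_real x)"
  shows "H z = K z"
proof -
  have "(0::complex) islimpt \<real>"
    unfolding islimpt_approachable
  proof (intro allI impI)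
    fix e :: real assume "0 < e"
    then show "\<exists>x'\<in>\<real>. x' \<noteq> (0::complex) \<and> dist x' 0 < e"
      by (intro bexI[of _ "of_real (e / 2)"]) auto
  qed
  moreover have "(\<lambda>z. H z - K z) holomorphic_on UNIV"
    using assms by (intro holomorphic_intros)
  ultimately have "H z - K z = 0"
    using analytic_continuation[of "\<lambda>z. H z - K z" UNIV \<real> 0 z] eq
    by (metis Reals_cases UNIV_I connected_UNIV open_UNIV right_minus_eq subset_UNIV)
  then show ?thesis by simp
qed

definition heat_kernel :: "real \<Rightarrow> complex \<Rightarrow> complex" where
  "heat_kernel \<alpha> w = exp (- (w\<^sup>2 / (2 * of_real \<alpha>))) / of_real (sqrt (2 * pi * \<alpha>))"

definition heat_extension :: "(real \<Rightarrow> real) \<Rightarrow> real \<Rightarrow> complex \<Rightarrow> complex" where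
  "heat_extension f \<alpha> z = (\<integral>t. of_real (f t) * heat_kernel \<alpha> (of_real t - z) \<partial>lborel)"

lemma heat_kernel_measurable[measurable]: "heat_kernel \<alpha> \<in> borel_measurable borel"
  unfolding heat_kernel_def by measurable

lemma heat_kernel_diff:
  assumes "0 < \<alpha>"
  shows "heat_kernel \<alpha> (w - v) = heat_kernel \<alpha> v * exp (- (w\<^sup>2 / (2 * of_real \<alpha>))) * exp (v / of_real \<alpha> * w)"
proof -
  have "- ((w - v)\<^sup>2 / (2 * of_real \<alpha>)) =
      - (v\<^sup>2 / (2 * of_real \<alpha>)) + - (w\<^sup>2 / (2 * of_real \<alpha>)) + v / of_real \<alpha> * w"
    using assms by (simp add: power2_diff field_simps)
  then show ?thesis
    unfolding heat_kernel_def by (simp only: exp_add times_divide_eq_left)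
qed

text \<open>
  By \<open>heat_kernel_diff\<close> the dependence on \<open>z\<close> splits into the factor \<open>heat_kernel \<alpha> z\<close> and a
  Laplace transform at \<open>z / \<alpha>\<close>.
\<close>

lemma heat_extension_entire:
  assumes f: "gaussian_integrable f" and a: "0 < \<alpha>"
  shows "heat_extension f \<alpha> holomorphic_on UNIV"
proof -
  have [measurable]: "f \<in> borel_measurable borel" using f by (simp add: gaussian_integrable_def)
  define g where "g t = f t * exp (- (1 / (2 * \<alpha>) * t\<^sup>2))" for t
  define L where "L = (\<lambda>z. \<integral>t. complex_of_real (g t) * exp (z * of_real t) \<partial>lborel)"
  have "L holomorphic_on UNIV"
    unfolding L_def
  proof (rule laplace_transform_entire)
    show "integrable lborel (\<lambda>t. g t * exp (b * \<bar>t\<bar>))" for b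
      unfolding g_def using f a by (intro gaussian_integrable_exp_abs) auto
  qed (simp add: g_def)
  moreover have "(\<lambda>z. z / of_real \<alpha>) holomorphic_on UNIV" "heat_kernel \<alpha> holomorphic_on UNIV"
    using a unfolding heat_kernel_def by (auto intro!: holomorphic_intros)
  ultimately have "(\<lambda>z. heat_kernel \<alpha> z * (L \<circ> (\<lambda>z. z / of_real \<alpha>)) z) holomorphic_on UNIV"
    by (intro holomorphic_on_mult holomorphic_on_compose_gen[where t = UNIV]) auto
  also have "(\<lambda>z. heat_kernel \<alpha> z * (L \<circ> (\<lambda>z. z / of_real \<alpha>)) z) = heat_extension f \<alpha>"
  proof
    fix z
    have "heat_extension f \<alpha> z =
        (\<integral>t. heat_kernel \<alpha> z * (of_real (g t) * exp (z / of_real \<alpha> * of_real t)) \<partial>lborel)"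
      unfolding heat_extension_def heat_kernel_diff[OF a]
      by (simp add: g_def exp_of_real mult_ac flip: of_real_power)
         (simp add: exp_of_real[symmetric] mult_ac)
    then show "heat_kernel \<alpha> z * (L \<circ> (\<lambda>z. z / of_real \<alpha>)) z = heat_extension f \<alpha> z"
      by (simp add: L_def)
  qed
  finally show ?thesis .
qed

section \<open>Gaussian averages of the heat kernel\<close>

text \<open>
  Both sides are entire in \<open>b\<close>, so real \<open>b\<close> suffice; there, completing the square turns the
  integrand into \<open>exp (b\<^sup>2 / 2)\<close> times a translated normal density.
\<close>

lemma std_normal_complex_mgf:
  "(\<integral>s. complex_of_real (std_normal_density s) * exp (b * of_real s) \<partial>lborel) = exp (b\<^sup>2 / 2)"
proof (rule entire_eqI_real[where z = b])
  have one: "gaussian_integrable (\<lambda>_. 1)"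
    unfolding gaussian_integrable_def
  proof (intro conjI allI impI)
    fix \<epsilon> :: real assume "0 < \<epsilon>"
    from integrable_power_exp_square[OF this, of 0]
    show "integrable lborel (\<lambda>t::real. 1 * exp (- (\<epsilon> * t\<^sup>2)))" by simp
  qed simp
  show "(\<lambda>b. \<integral>s. complex_of_real (std_normal_density s) * exp (b * of_real s) \<partial>lborel) holomorphic_on UNIV"
  proof (rule laplace_transform_entire)
    fix c :: real
    have "integrable lborel (\<lambda>s. 1 / sqrt (2 * pi) * (1 * exp (- (1 / 2 * s\<^sup>2)) * exp (c * \<bar>s\<bar>)))"
      by (intro integrable_mult_right gaussian_integrable_exp_abs one) simp
    then show "integrable lborel (\<lambda>s. std_normal_density s * exp (c * \<bar>s\<bar>))"
      by (simp add: std_normal_density_def)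
  qed simp
  show "(\<lambda>b. exp (b\<^sup>2 / 2)) holomorphic_on UNIV"
    by (intro holomorphic_intros) auto
  fix x :: real
  have sq: "std_normal_density s * exp (x * s) = exp (x\<^sup>2 / 2) * std_normal_density (- x + 1 * s)" for s
    by (simp add: std_normal_density_def field_simps power2_eq_square flip: exp_add)
  have "(\<integral>s. std_normal_density s * exp (x * s) \<partial>lborel) = exp (x\<^sup>2 / 2)"
    unfolding sq using lborel_integral_real_affine[of 1 std_normal_density "-x"]
    by (simp add: integral_normal_density)
  then have "complex_of_real (\<integral>s. std_normal_density s * exp (x * s) \<partial>lborel) = of_real (exp (x\<^sup>2 / 2))"
    by simp
  then show "(\<integral>s. of_real (std_normal_density s) * exp (of_real x * of_real s) \<partial>lborel) =
      exp ((complex_of_real x)\<^sup>2 / 2)"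
    by (simp add: integral_complex_of_real[symmetric] exp_of_real[symmetric] del: integral_complex_of_real)
qed

text \<open>
  For \<open>\<sigma> = sqrt \<tau>\<close> this is the convolution of two normal densities; for \<open>\<sigma> = \<i> sqrt (- \<tau>)\<close> it
  undoes such a convolution.
\<close>

lemma gaussian_average_heat_kernel:
  assumes a: "0 < \<alpha>" and at: "0 < \<alpha> + \<tau>" and sg: "\<sigma>\<^sup>2 = of_real \<tau>"
  shows "(\<integral>s. of_real (std_normal_density s) * heat_kernel \<alpha> (w - \<sigma> * of_real s) \<partial>lborel) =
    heat_kernel (\<alpha> + \<tau>) w"
proof -
  \<comment> \<open>The coefficient of \<open>- s\<^sup>2 / 2\<close> in the exponent is \<open>1 + \<sigma>\<^sup>2 / \<alpha> = (\<alpha> + \<tau>) / \<alpha>\<close>, so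
    \<open>s = r / l\<close> makes it \<open>1\<close>; then \<open>b\<close> is the coefficient of the linear term.\<close>
  define l where "l = sqrt ((\<alpha> + \<tau>) / \<alpha>)"
  have l: "l > 0" "l\<^sup>2 = (\<alpha> + \<tau>) / \<alpha>" using a at by (simp_all add: l_def)
  define b where "b = w * \<sigma> / of_real (\<alpha> * l)"
  have cl: "(complex_of_real l)\<^sup>2 = of_real ((\<alpha> + \<tau>) / \<alpha>)"
    using l(2) by (simp flip: of_real_power)
  have scaled: "of_real (std_normal_density (0 + 1 / l * r)) *
       heat_kernel \<alpha> (w - \<sigma> * of_real (0 + 1 / l * r)) =
     heat_kernel \<alpha> w * (of_real (std_normal_density r) * exp (b * of_real r))" for r
  proof -
    have "- ((complex_of_real r / of_real l)\<^sup>2 / 2) -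
        (w - \<sigma> * (of_real r / of_real l))\<^sup>2 / (2 * of_real \<alpha>) =
      - (w\<^sup>2 / (2 * of_real \<alpha>)) + (- ((of_real r)\<^sup>2 / 2) + b * of_real r)"
      (is "?L = ?R")
    proof -
      have "?L = - (w\<^sup>2 / (2 * of_real \<alpha>)) + b * of_real r
          - (of_real r)\<^sup>2 / 2 * ((1 + \<sigma>\<^sup>2 / of_real \<alpha>) / (of_real l)\<^sup>2)"
        using a l(1) by (simp add: b_def field_simps power2_eq_square)
      also have "(1 + \<sigma>\<^sup>2 / of_real \<alpha>) / (of_real l)\<^sup>2 = 1"
        using a at by (simp add: cl sg field_simps flip: of_real_add)
      finally show ?thesis by simp
    qed
    then have "exp (- ((complex_of_real r / of_real l)\<^sup>2 / 2)) *
        exp (- ((w - \<sigma> * (of_real r / of_real l))\<^sup>2 / (2 * of_real \<alpha>))) =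
      exp (- (w\<^sup>2 / (2 * of_real \<alpha>))) * (exp (- ((of_real r)\<^sup>2 / 2)) * exp (b * of_real r))"
      by (simp flip: exp_add)
    then show ?thesis
      by (simp add: heat_kernel_def std_normal_density_def exp_of_real[symmetric])
  qed
  have bb: "exp (b\<^sup>2 / 2) * heat_kernel \<alpha> w = of_real l * heat_kernel (\<alpha> + \<tau>) w"
  proof -
    have "b\<^sup>2 = w\<^sup>2 * \<sigma>\<^sup>2 / ((of_real \<alpha>)\<^sup>2 * (of_real l)\<^sup>2)"
      by (simp add: b_def power_divide power_mult_distrib)
    also have "\<dots> = w\<^sup>2 * of_real (\<tau> / (\<alpha> * (\<alpha> + \<tau>)))"
      unfolding cl sg using a at by (simp add: power2_eq_square)
    finally have b2: "b\<^sup>2 = w\<^sup>2 * of_real (\<tau> / (\<alpha> * (\<alpha> + \<tau>)))" .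
    have "b\<^sup>2 / 2 - w\<^sup>2 / (2 * of_real \<alpha>) = w\<^sup>2 / 2 * of_real (\<tau> / (\<alpha> * (\<alpha> + \<tau>)) - 1 / \<alpha>)"
      unfolding b2 by (simp add: right_diff_distrib mult_ac)
    also have "\<tau> / (\<alpha> * (\<alpha> + \<tau>)) - 1 / \<alpha> = - 1 / (\<alpha> + \<tau>)"
    proof -
      have "\<alpha> \<noteq> 0" "\<alpha> + \<tau> \<noteq> 0" using a at by auto
      then show ?thesis by (simp add: divide_simps)
    qed
    finally have "exp (b\<^sup>2 / 2) * exp (- (w\<^sup>2 / (2 * of_real \<alpha>))) =
        exp (- (w\<^sup>2 / (2 * of_real (\<alpha> + \<tau>))))"
      by (simp flip: exp_add)
    moreover have "sqrt (2 * pi * (\<alpha> + \<tau>)) = l * sqrt (2 * pi * \<alpha>)"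
      using a by (simp add: l_def flip: real_sqrt_mult)
    ultimately show ?thesis
      using l(1) by (simp add: heat_kernel_def)
  qed
  have "(\<integral>s. of_real (std_normal_density s) * heat_kernel \<alpha> (w - \<sigma> * of_real s) \<partial>lborel) =
      \<bar>1 / l\<bar> *\<^sub>R (\<integral>r. heat_kernel \<alpha> w * (of_real (std_normal_density r) * exp (b * of_real r)) \<partial>lborel)"
    using l by (subst lborel_integral_real_affine[where c = "1 / l" and t = 0])
      (simp_all only: scaled, auto)
  also have "\<dots> = heat_kernel (\<alpha> + \<tau>) w"
    using bb l(1) by (simp add: std_normal_complex_mgf scaleR_conv_of_real field_simps)
  finally show ?thesis .
qed

lemma norm_heat_kernel:
  assumes "0 < \<alpha>"
  shows "norm (heat_kernel \<alpha> w) = exp (((Im w)\<^sup>2 - (Re w)\<^sup>2) / (2 * \<alpha>)) / sqrt (2 * pi * \<alpha>)"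
proof -
  have "Re (- (w\<^sup>2 / (2 * of_real \<alpha>))) = ((Im w)\<^sup>2 - (Re w)\<^sup>2) / (2 * \<alpha>)"
    using assms by (simp add: Re_power2 Re_divide_of_real[of _ "2 * \<alpha>", simplified] field_simps)
  then show ?thesis
    using assms by (simp add: heat_kernel_def norm_divide del: Re_divide)
qed

text \<open>
  With small \<open>\<theta>\<close> this keeps a part of \<open>u\<^sup>2\<close> at the cost of only a small multiple of \<open>v\<^sup>2\<close>, which
  the decay already available in \<open>v\<close> can pay for.
\<close>

lemma square_diff_lower:
  fixes u v \<theta> :: real
  assumes "0 < \<theta>"
  shows "\<theta> / (1 + \<theta>) * u\<^sup>2 - \<theta> * v\<^sup>2 \<le> (u - v)\<^sup>2"
proof -
  have "0 \<le> (u - (1 + \<theta>) * v)\<^sup>2 / (1 + \<theta>)" using assms by simp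
  also have "\<dots> = (u - v)\<^sup>2 - (\<theta> / (1 + \<theta>) * u\<^sup>2 - \<theta> * v\<^sup>2)"
    using assms by (simp add: field_simps power2_eq_square)
  finally show ?thesis by simp
qed

text \<open>
  With \<open>z = x + \<i>y\<close> and \<open>\<sigma> = p + \<i>q\<close> the modulus has the exponent
  \<open>- s\<^sup>2 / 2 + ((y + qs)\<^sup>2 - (t - x - ps)\<^sup>2) / (2\<alpha>)\<close>. The first two squares combine to
  \<open>- \<delta> s\<^sup>2\<close> plus lower order terms, where \<open>\<delta> = (1 - q\<^sup>2 / \<alpha>) / 2\<close> is positive exactly because
  \<open>q\<^sup>2 < \<alpha>\<close>. The last square provides the decay in \<open>t\<close>.
\<close>

lemma heat_kernel_gaussian_bound:
  assumes a: "0 < \<alpha>" and q: "(Im \<sigma>)\<^sup>2 < \<alpha>"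
  obtains C \<epsilon> where "0 < \<epsilon>"
    "\<And>t s. norm (of_real (std_normal_density s) * heat_kernel \<alpha> (of_real t - (z + \<sigma> * of_real s)))
        \<le> C * (exp (- (\<epsilon> * t\<^sup>2)) * exp (- (\<epsilon> * s\<^sup>2)))"
proof -
  define x y p q where "x = Re z" and "y = Im z" and "p = Re \<sigma>" and "q = Im \<sigma>"
  define \<delta> where "\<delta> = (1 - q\<^sup>2 / \<alpha>) / 2"
  have d: "\<delta> > 0" using a q by (simp add: \<delta>_def q_def)
  \<comment> \<open>Half of \<open>\<delta>\<close> absorbs the term linear in \<open>s\<close>. The choice of \<open>\<theta>\<close> makes the loss from
    \<open>square_diff_lower\<close> at most another quarter, so that \<open>\<delta> / 4\<close> is left over.\<close>
  define \<theta> where "\<theta> = \<alpha> * \<delta> / (4 * (p\<^sup>2 + 1))"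
  have pp: "p\<^sup>2 + 1 > 0" by (simp add: add_nonneg_pos)
  have th: "\<theta> > 0" using a d pp by (simp add: \<theta>_def)
  define \<epsilon> where "\<epsilon> = min (\<delta> / 4) (\<theta> / (1 + \<theta>) / (2 * \<alpha>))"
  define B where "B = y\<^sup>2 / (2 * \<alpha>) + (y * q / \<alpha>)\<^sup>2 / (2 * \<delta>) + \<theta> * x\<^sup>2 / \<alpha>"
  have eps: "\<epsilon> > 0" using a d th by (simp add: \<epsilon>_def)
  have expo: "- s\<^sup>2 / 2 + ((y + q * s)\<^sup>2 - (t - (x + p * s))\<^sup>2) / (2 * \<alpha>) \<le> B - \<epsilon> * t\<^sup>2 - \<epsilon> * s\<^sup>2"
    for s t
  proof -
    have "- s\<^sup>2 / 2 + (y + q * s)\<^sup>2 / (2 * \<alpha>) = y\<^sup>2 / (2 * \<alpha>) + (y * q / \<alpha>) * s - \<delta> * s\<^sup>2"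
      using a by (simp add: \<delta>_def field_simps power2_eq_square)
    also have "\<dots> \<le> y\<^sup>2 / (2 * \<alpha>) + (y * q / \<alpha>)\<^sup>2 / (2 * \<delta>) - \<delta> / 2 * s\<^sup>2"
      using linear_le_square[of "\<delta> / 2" "y * q / \<alpha>" s] d by simp
    finally have 1: "- s\<^sup>2 / 2 + (y + q * s)\<^sup>2 / (2 * \<alpha>) \<le>
        y\<^sup>2 / (2 * \<alpha>) + (y * q / \<alpha>)\<^sup>2 / (2 * \<delta>) - \<delta> / 2 * s\<^sup>2" .
    have "(x + p * s)\<^sup>2 \<le> 2 * x\<^sup>2 + 2 * p\<^sup>2 * s\<^sup>2"
      using zero_le_power2[of "x - p * s"] by (simp add: power2_eq_square algebra_simps)
    also have "\<dots> \<le> 2 * x\<^sup>2 + 2 * (p\<^sup>2 + 1) * s\<^sup>2"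
      by (simp add: algebra_simps)
    finally have "\<theta> * (x + p * s)\<^sup>2 \<le> \<theta> * (2 * x\<^sup>2 + 2 * (p\<^sup>2 + 1) * s\<^sup>2)"
      using th by (intro mult_left_mono) auto
    also have "\<dots> = 2 * \<theta> * x\<^sup>2 + \<alpha> * \<delta> / 2 * s\<^sup>2"
      using pp by (simp add: \<theta>_def field_simps)
    finally have "\<theta> / (1 + \<theta>) * t\<^sup>2 - (2 * \<theta> * x\<^sup>2 + \<alpha> * \<delta> / 2 * s\<^sup>2) \<le> (t - (x + p * s))\<^sup>2"
      using square_diff_lower[OF th, of t "x + p * s"] by linarith
    then have "(\<theta> / (1 + \<theta>) * t\<^sup>2 - (2 * \<theta> * x\<^sup>2 + \<alpha> * \<delta> / 2 * s\<^sup>2)) / (2 * \<alpha>) \<le>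
        (t - (x + p * s))\<^sup>2 / (2 * \<alpha>)"
      using a by (intro divide_right_mono) auto
    moreover have "(\<theta> / (1 + \<theta>) * t\<^sup>2 - (2 * \<theta> * x\<^sup>2 + \<alpha> * \<delta> / 2 * s\<^sup>2)) / (2 * \<alpha>) =
        \<theta> / (1 + \<theta>) / (2 * \<alpha>) * t\<^sup>2 - \<theta> * x\<^sup>2 / \<alpha> - \<delta> / 4 * s\<^sup>2"
      using a by (simp add: diff_divide_distrib add_divide_distrib)
    ultimately have 2: "\<theta> / (1 + \<theta>) / (2 * \<alpha>) * t\<^sup>2 - \<theta> * x\<^sup>2 / \<alpha> - \<delta> / 4 * s\<^sup>2 \<le>
        (t - (x + p * s))\<^sup>2 / (2 * \<alpha>)" by simp
    have 3: "\<epsilon> * t\<^sup>2 \<le> \<theta> / (1 + \<theta>) / (2 * \<alpha>) * t\<^sup>2" "\<epsilon> * s\<^sup>2 \<le> \<delta> / 4 * s\<^sup>2"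
      unfolding \<epsilon>_def by (intro mult_right_mono min.cobounded1 min.cobounded2 zero_le_power2)+
    show ?thesis using 1 2 3 unfolding B_def diff_divide_distrib by linarith
  qed
  show ?thesis
  proof
    show "0 < \<epsilon>" by fact
    fix t s
    define w where "w = of_real t - (z + \<sigma> * of_real s)"
    have w: "Re w = t - (x + p * s)" "Im w = - (y + q * s)"
      by (simp_all add: w_def x_def y_def p_def q_def)
    have "norm (of_real (std_normal_density s) * heat_kernel \<alpha> w) =
       1 / (sqrt (2 * pi) * sqrt (2 * pi * \<alpha>)) *
       exp (- s\<^sup>2 / 2 + ((y + q * s)\<^sup>2 - (t - (x + p * s))\<^sup>2) / (2 * \<alpha>))"
      unfolding norm_mult norm_heat_kernel[OF a] w power2_minus exp_add
      by (simp add: std_normal_density_def norm_divide)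
    also have "\<dots> \<le> 1 / (sqrt (2 * pi) * sqrt (2 * pi * \<alpha>)) * exp (B - \<epsilon> * t\<^sup>2 - \<epsilon> * s\<^sup>2)"
      using expo[of s t] a by (intro mult_left_mono) auto
    also have "\<dots> = exp B / (sqrt (2 * pi) * sqrt (2 * pi * \<alpha>)) * (exp (- (\<epsilon> * t\<^sup>2)) * exp (- (\<epsilon> * s\<^sup>2)))"
      by (simp add: exp_diff exp_minus exp_add field_simps)
    finally show "norm (of_real (std_normal_density s) * heat_kernel \<alpha> (of_real t - (z + \<sigma> * of_real s)))
      \<le> exp B / (sqrt (2 * pi) * sqrt (2 * pi * \<alpha>)) * (exp (- (\<epsilon> * t\<^sup>2)) * exp (- (\<epsilon> * s\<^sup>2)))"
      unfolding w_def .
  qed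
qed

section \<open>Exchanging the two integrals\<close>

lemma joint_integrable_heat_kernel:
  assumes f: "gaussian_integrable f" and a: "0 < \<alpha>" and q: "(Im \<sigma>)\<^sup>2 < \<alpha>"
  shows "integrable (lborel \<Otimes>\<^sub>M lborel) (\<lambda>(t, s). of_real (f t) *
    (of_real (std_normal_density s) * heat_kernel \<alpha> (of_real t - (z + \<sigma> * of_real s))))"
proof -
  have [measurable]: "f \<in> borel_measurable borel" using f by (simp add: gaussian_integrable_def)
  obtain C \<epsilon> where eps: "0 < \<epsilon>" and bnd:
    "\<And>t s. norm (of_real (std_normal_density s) * heat_kernel \<alpha> (of_real t - (z + \<sigma> * of_real s)))
        \<le> C * (exp (- (\<epsilon> * t\<^sup>2)) * exp (- (\<epsilon> * s\<^sup>2)))"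
    using heat_kernel_gaussian_bound[OF a q, of z] by metis
  have ft: "integrable lborel (\<lambda>t. f t * exp (- (\<epsilon> * t\<^sup>2)))"
    using f eps by (simp add: gaussian_integrable_def)
  have es: "integrable lborel (\<lambda>s. exp (- (\<epsilon> * s\<^sup>2)))"
    using integrable_power_exp_square[OF eps, of 0] by simp
  have "integrable (lborel \<Otimes>\<^sub>M lborel)
      (\<lambda>(t, s). C * (f t * exp (- (\<epsilon> * t\<^sup>2)) * exp (- (\<epsilon> * s\<^sup>2))))"
  proof (rule lborel_pair.Fubini_integrable)
    show "integrable lborel (\<lambda>t. \<integral>s. norm (case (t, s) of (t, s) \<Rightarrow>
        C * (f t * exp (- (\<epsilon> * t\<^sup>2)) * exp (- (\<epsilon> * s\<^sup>2)))) \<partial>lborel)"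
      using integrable_mult_right[OF integrable_abs[OF ft],
          of "\<bar>C\<bar> * (\<integral>s. exp (- (\<epsilon> * s\<^sup>2)) \<partial>lborel)"]
      by (simp add: abs_mult mult_ac)
    show "AE t in lborel. integrable lborel (\<lambda>s. case (t, s) of (t, s) \<Rightarrow>
        C * (f t * exp (- (\<epsilon> * t\<^sup>2)) * exp (- (\<epsilon> * s\<^sup>2))))"
      using es by simp
  qed measurable
  then show ?thesis
  proof (rule Bochner_Integration.integrable_bound)
    show "AE ts in lborel \<Otimes>\<^sub>M lborel. norm (case ts of (t, s) \<Rightarrow> of_real (f t) *
         (of_real (std_normal_density s) * heat_kernel \<alpha> (of_real t - (z + \<sigma> * of_real s))))
       \<le> norm (case ts of (t, s) \<Rightarrow> C * (f t * exp (- (\<epsilon> * t\<^sup>2)) * exp (- (\<epsilon> * s\<^sup>2))))"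
    proof (intro always_eventually allI, clarify)
      fix t s
      have "norm (complex_of_real (f t) *
          (of_real (std_normal_density s) * heat_kernel \<alpha> (of_real t - (z + \<sigma> * of_real s))))
        \<le> \<bar>f t\<bar> * (C * (exp (- (\<epsilon> * t\<^sup>2)) * exp (- (\<epsilon> * s\<^sup>2))))"
        unfolding norm_mult[of "of_real (f t)"] norm_of_real by (intro mult_left_mono bnd) auto
      also have "\<dots> \<le> norm (C * (f t * exp (- (\<epsilon> * t\<^sup>2)) * exp (- (\<epsilon> * s\<^sup>2))))"
        using abs_ge_self[of "\<bar>f t\<bar> * (C * (exp (- (\<epsilon> * t\<^sup>2)) * exp (- (\<epsilon> * s\<^sup>2))))"]
        by (simp add: abs_mult mult_ac)
      finally show "norm (of_real (f t) *
          (of_real (std_normal_density s) * heat_kernel \<alpha> (of_real t - (z + \<sigma> * of_real s))))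
        \<le> norm (C * (f t * exp (- (\<epsilon> * t\<^sup>2)) * exp (- (\<epsilon> * s\<^sup>2))))" .
    qed
  qed measurable
qed

lemma heat_extension_semigroup:
  assumes f: "gaussian_integrable f"
    and a: "0 < \<alpha>" and at: "0 < \<alpha> + \<tau>" and sg: "\<sigma>\<^sup>2 = of_real \<tau>"
  shows "integrable lborel (\<lambda>s. of_real (std_normal_density s) * heat_extension f \<alpha> (z + \<sigma> * of_real s))"
    and "heat_extension f (\<alpha> + \<tau>) z =
      (\<integral>s. of_real (std_normal_density s) * heat_extension f \<alpha> (z + \<sigma> * of_real s) \<partial>lborel)"
proof -
  have [measurable]: "f \<in> borel_measurable borel" using f by (simp add: gaussian_integrable_def)
  \<comment> \<open>As \<open>\<sigma>\<^sup>2\<close> is real, \<open>\<sigma>\<close> lies on one of the axes: either \<open>Im \<sigma> = 0\<close>, or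
    \<open>(Im \<sigma>)\<^sup>2 = - \<tau> < \<alpha>\<close>.\<close>
  have "(Re \<sigma>)\<^sup>2 - (Im \<sigma>)\<^sup>2 = \<tau>" "2 * Re \<sigma> * Im \<sigma> = 0"
    using sg by (auto simp: complex_eq_iff Re_power2 Im_power2)
  then have q: "(Im \<sigma>)\<^sup>2 < \<alpha>" using a at by auto
  let ?F = "\<lambda>t s. of_real (f t) *
    (of_real (std_normal_density s) * heat_kernel \<alpha> (of_real t - (z + \<sigma> * of_real s)))"
  note J = joint_integrable_heat_kernel[OF f a q, of z]
  have inner: "(\<integral>t. ?F t s \<partial>lborel) =
      of_real (std_normal_density s) * heat_extension f \<alpha> (z + \<sigma> * of_real s)" for s
    unfolding heat_extension_def integral_mult_right_zero[symmetric] by (simp add: mult_ac)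
  show "integrable lborel (\<lambda>s. of_real (std_normal_density s) * heat_extension f \<alpha> (z + \<sigma> * of_real s))"
    using lborel_pair.integrable_snd[OF J] by (simp only: inner)
  have "heat_extension f (\<alpha> + \<tau>) z = (\<integral>t. (\<integral>s. ?F t s \<partial>lborel) \<partial>lborel)"
    unfolding heat_extension_def
    using gaussian_average_heat_kernel[OF a at sg] by (simp add: diff_diff_eq[symmetric])
  also have "\<dots> = (\<integral>s. (\<integral>t. ?F t s \<partial>lborel) \<partial>lborel)"
    by (rule lborel_pair.Fubini_integral[symmetric]) (rule J)
  finally show "heat_extension f (\<alpha> + \<tau>) z =
      (\<integral>s. of_real (std_normal_density s) * heat_extension f \<alpha> (z + \<sigma> * of_real s) \<partial>lborel)"
    by (simp only: inner)
qed

section \<open>From the random variable to Lebesgue integrals\<close>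

text \<open>
  The counterpart, for complex-valued \<open>g\<close>, of the real-valued
  \<open>distributed_integrable\<close> and \<open>distributed_integral\<close>.
\<close>

lemma distributed_complex_integral:
  fixes g :: "real \<Rightarrow> complex" and X :: "'w \<Rightarrow> real" and p :: "real \<Rightarrow> real"
  assumes X: "distributed M lborel X (\<lambda>x. ennreal (p x))" and nn: "\<And>x. 0 \<le> p x"
    and g[measurable]: "g \<in> borel_measurable borel"
  shows "integrable M (\<lambda>\<omega>. g (X \<omega>)) \<longleftrightarrow> integrable lborel (\<lambda>x. of_real (p x) * g x)"
    and "(\<integral>\<omega>. g (X \<omega>) \<partial>M) = (\<integral>x. of_real (p x) * g x \<partial>lborel)"
proof -
  have [measurable]: "X \<in> borel_measurable M" "p \<in> borel_measurable borel"
    using distributed_measurable[OF X] distributed_real_measurable[OF _ X] nn by auto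
  show "integrable M (\<lambda>\<omega>. g (X \<omega>)) \<longleftrightarrow> integrable lborel (\<lambda>x. of_real (p x) * g x)"
    using distributed_distr_eq_density[OF X] integrable_distr_eq[of X M lborel g]
    by (simp add: integrable_density nn scaleR_conv_of_real)
  show "(\<integral>\<omega>. g (X \<omega>) \<partial>M) = (\<integral>x. of_real (p x) * g x \<partial>lborel)"
    using distributed_distr_eq_density[OF X] integral_distr[of X M lborel g]
    by (simp add: integral_density nn scaleR_conv_of_real)
qed

lemma heat_kernel_of_real:
  assumes "0 < \<alpha>"
  shows "heat_kernel \<alpha> (of_real u) = of_real (std_normal_density (u / sqrt \<alpha>) / sqrt \<alpha>)"
  using assms
  by (simp add: heat_kernel_def std_normal_density_def power_divide real_sqrt_mult exp_of_real[symmetric] mult.commute)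

lemma heat_extension_of_real:
  assumes "0 < \<alpha>"
  shows "heat_extension f \<alpha> (of_real x) =
    of_real (\<integral>t. f t * std_normal_density ((t - x) / sqrt \<alpha>) / sqrt \<alpha> \<partial>lborel)"
proof -
  have "of_real (f t) * heat_kernel \<alpha> (of_real t - of_real x) =
      complex_of_real (f t * std_normal_density ((t - x) / sqrt \<alpha>) / sqrt \<alpha>)" for t
    using heat_kernel_of_real[OF assms, of "t - x"] by simp
  then show ?thesis
    unfolding heat_extension_def by (simp only: integral_complex_of_real)
qed

text \<open>
  The two integrals differ by the substitution \<open>t = x + sqrt \<alpha> s\<close>. Integrability is proved on the
  side of \<open>t\<close>, where the shift by \<open>x\<close> only costs a factor \<open>exp (\<bar>x\<bar> \<bar>t\<bar> / \<alpha>)\<close>.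
\<close>

lemma gaussian_smoothing_integral:
  fixes M :: "'w measure" and \<xi> :: "'w \<Rightarrow> real"
  assumes D: "distributed M lborel \<xi> (\<lambda>x. ennreal (std_normal_density x))"
    and f: "gaussian_integrable f" and a: "0 < \<alpha>"
  shows "integrable lborel (\<lambda>t. f t * std_normal_density ((t - x) / sqrt \<alpha>) / sqrt \<alpha>)" (is ?I)
    and "integrable M (\<lambda>\<omega>. f (x + sqrt \<alpha> * \<xi> \<omega>))"
    and "gaussian_smoothing M \<xi> f x \<alpha> =
      (\<integral>t. f t * std_normal_density ((t - x) / sqrt \<alpha>) / sqrt \<alpha> \<partial>lborel)"
proof -
  have [measurable]: "f \<in> borel_measurable borel" using f by (simp add: gaussian_integrable_def)
  define g where "g t = f t * std_normal_density ((t - x) / sqrt \<alpha>) / sqrt \<alpha>" for t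
  have ga: "g (x + sqrt \<alpha> * s) = std_normal_density s * f (x + sqrt \<alpha> * s) / sqrt \<alpha>" for s
    using a by (simp add: g_def)
  have int: "integrable lborel g"
  proof (rule Bochner_Integration.integrable_bound)
    let ?G = "\<lambda>t. exp (- (x\<^sup>2 / (2 * \<alpha>))) / sqrt (2 * pi * \<alpha>) *
        (f t * exp (- (1 / (2 * \<alpha>) * t\<^sup>2)) * exp (\<bar>x\<bar> / \<alpha> * \<bar>t\<bar>))"
    show "integrable lborel ?G"
      using a by (intro integrable_mult_right gaussian_integrable_exp_abs f) simp
    show "AE t in lborel. norm (g t) \<le> norm (?G t)"
    proof (intro always_eventually allI)
      fix t
      have "exp (- (((t - x) / sqrt \<alpha>)\<^sup>2 / 2)) =
          exp (- (x\<^sup>2 / (2 * \<alpha>))) * exp (- (1 / (2 * \<alpha>) * t\<^sup>2)) * exp (x * t / \<alpha>)"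
        using a by (simp add: power_divide field_simps power2_eq_square flip: exp_add)
      then have "norm (g t) = \<bar>f t\<bar> * (exp (- (x\<^sup>2 / (2 * \<alpha>))) / sqrt (2 * pi * \<alpha>) *
          exp (- (1 / (2 * \<alpha>) * t\<^sup>2))) * exp (x * t / \<alpha>)"
        using a by (simp add: g_def std_normal_density_def abs_mult real_sqrt_mult)
      also have "\<dots> \<le> \<bar>f t\<bar> * (exp (- (x\<^sup>2 / (2 * \<alpha>))) / sqrt (2 * pi * \<alpha>) *
          exp (- (1 / (2 * \<alpha>) * t\<^sup>2))) * exp (\<bar>x\<bar> / \<alpha> * \<bar>t\<bar>)"
        using a abs_ge_self[of "x * t"]
        by (intro mult_left_mono) (simp_all add: divide_right_mono abs_mult)
      also have "\<dots> = norm (?G t)"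
        using a by (simp add: abs_mult)
      finally show "norm (g t) \<le> norm (?G t)" .
    qed
  qed (simp add: g_def[abs_def])
  then show ?I by (simp add: g_def[abs_def])
  have "integrable lborel (\<lambda>s. sqrt \<alpha> * g (x + sqrt \<alpha> * s))"
    using lborel_integrable_real_affine[OF int, of "sqrt \<alpha>" x] a by (intro integrable_mult_right) auto
  then show "integrable M (\<lambda>\<omega>. f (x + sqrt \<alpha> * \<xi> \<omega>))"
    using distributed_integrable[OF D, of "\<lambda>s. f (x + sqrt \<alpha> * s)"] a by (simp add: ga)
  have "gaussian_smoothing M \<xi> f x \<alpha> = (\<integral>s. std_normal_density s * f (x + sqrt \<alpha> * s) \<partial>lborel)"
    unfolding gaussian_smoothing_def
    using distributed_integral[OF D, of "\<lambda>s. f (x + sqrt \<alpha> * s)"] by simp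
  also have "\<dots> = (\<integral>s. sqrt \<alpha> * g (x + sqrt \<alpha> * s) \<partial>lborel)"
    using a by (simp add: ga)
  also have "\<dots> = integral\<^sup>L lborel g"
    using a by (subst (2) lborel_integral_real_affine[of "sqrt \<alpha>" _ x]) auto
  finally show "gaussian_smoothing M \<xi> f x \<alpha> =
      (\<integral>t. f t * std_normal_density ((t - x) / sqrt \<alpha>) / sqrt \<alpha> \<partial>lborel)"
    by (simp only: g_def[abs_def])
qed

section \<open>Entire extensions of Gaussian smoothings\<close>

theorem lemma3p5:
  fixes M :: "'w measure" and \<xi> :: "'w \<Rightarrow> real" and f :: "real \<Rightarrow> real"
  assumes "prob_space M"
    and "distributed M lborel \<xi> (\<lambda>x. ennreal (std_normal_density x))"
    and "f \<in> borel_measurable borel"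
    and "locally_integrable f"
    and "polynomial_growth f"
  defines "h \<equiv> gaussian_smoothing M \<xi> f"
  shows
    "(\<forall>x. \<forall>\<alpha>>0.
        integrable M (\<lambda>\<omega>. f (x + sqrt \<alpha> * \<xi> \<omega>)) \<and>
        integrable lborel (\<lambda>t. f t * std_normal_density ((t - x) / sqrt \<alpha>) / sqrt \<alpha>) \<and>
        h x \<alpha> = (\<integral>t. f t * std_normal_density ((t - x) / sqrt \<alpha>) / sqrt \<alpha> \<partial>lborel)) \<and>
     (\<forall>\<alpha>>0. \<exists>H. entire_extension (\<lambda>x. h x \<alpha>) H) \<and>
     (\<forall>\<alpha>>0. \<forall>\<beta>>0. \<forall>H K.
        entire_extension (\<lambda>x. h x \<alpha>) H \<longrightarrow> entire_extension (\<lambda>x. h x (\<alpha> + \<beta>)) K \<longrightarrow>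
        (\<forall>z. integrable M (\<lambda>\<omega>. H (z + complex_of_real (sqrt \<beta> * \<xi> \<omega>))) \<and>
             K z = (\<integral>\<omega>. H (z + complex_of_real (sqrt \<beta> * \<xi> \<omega>)) \<partial>M))) \<and>
     (\<forall>\<alpha>>0. \<forall>\<beta>>0. \<forall>H K.
        entire_extension (\<lambda>x. h x \<alpha>) H \<longrightarrow> entire_extension (\<lambda>x. h x (\<alpha> + \<beta>)) K \<longrightarrow>
        (\<forall>z. integrable M (\<lambda>\<omega>. K (z + \<i> * complex_of_real (sqrt \<beta> * \<xi> \<omega>))) \<and>
             H z = (\<integral>\<omega>. K (z + \<i> * complex_of_real (sqrt \<beta> * \<xi> \<omega>)) \<partial>M)))"
proof -
  note D = assms(2)
  have f: "gaussian_integrable f"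
    using assms(3-5) by (rule polynomial_growth_gaussian_integrable)
  note smooth = gaussian_smoothing_integral[OF D f, folded h_def]
  have ext: "entire_extension (\<lambda>x. h x \<alpha>) (heat_extension f \<alpha>)" if "0 < \<alpha>" for \<alpha>
    using heat_extension_entire[OF f that] heat_extension_of_real[OF that] smooth(3)[OF that]
    by (simp add: entire_extension_def)
  have uniq: "H = heat_extension f \<alpha>" if "0 < \<alpha>" "entire_extension (\<lambda>x. h x \<alpha>) H" for \<alpha> H
    using ext[OF that(1)] that(2) unfolding entire_extension_def fun_eq_iff
    by (metis entire_eqI_real)
  have average: "integrable M (\<lambda>\<omega>. heat_extension f \<alpha> (z + \<sigma> * of_real (\<xi> \<omega>))) \<and>
      heat_extension f (\<alpha> + \<tau>) z = (\<integral>\<omega>. heat_extension f \<alpha> (z + \<sigma> * of_real (\<xi> \<omega>)) \<partial>M)"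
    if a: "0 < \<alpha>" and at: "0 < \<alpha> + \<tau>" and sg: "\<sigma>\<^sup>2 = of_real \<tau>" for \<alpha> \<tau> \<sigma> z
  proof -
    have "continuous_on UNIV (heat_extension f \<alpha>)"
      using heat_extension_entire[OF f a] by (rule holomorphic_on_imp_continuous_on)
    then have [measurable]: "heat_extension f \<alpha> \<in> borel_measurable borel"
      by (rule borel_measurable_continuous_onI)
    have m: "(\<lambda>s. heat_extension f \<alpha> (z + \<sigma> * of_real s)) \<in> borel_measurable borel"
      by measurable
    show ?thesis
      using heat_extension_semigroup[OF f a at sg, of z]
        distributed_complex_integral[OF D _ m] by simp
  qed
  show ?thesis
  proof (intro conjI allI impI)
    fix \<alpha> \<beta> :: real and H K z
    assume a: "0 < \<alpha>" and b: "0 < \<beta>"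
      and H: "entire_extension (\<lambda>x. h x \<alpha>) H" and K: "entire_extension (\<lambda>x. h x (\<alpha> + \<beta>)) K"
    have ab: "0 < \<alpha> + \<beta>" using a b by simp
    note HK = uniq[OF a H] uniq[OF ab K]
    have "(complex_of_real (sqrt \<beta>))\<^sup>2 = of_real \<beta>" using b by (simp flip: of_real_power)
    from average[OF a ab this, of z]
    show "integrable M (\<lambda>\<omega>. H (z + complex_of_real (sqrt \<beta> * \<xi> \<omega>)))"
      "K z = (\<integral>\<omega>. H (z + complex_of_real (sqrt \<beta> * \<xi> \<omega>)) \<partial>M)"
      by (simp_all add: HK)
    have "(\<i> * complex_of_real (sqrt \<beta>))\<^sup>2 = of_real (- \<beta>)"
      using b by (simp add: power_mult_distrib flip: of_real_power)
    from average[OF ab _ this, of z] a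
    show "integrable M (\<lambda>\<omega>. K (z + \<i> * complex_of_real (sqrt \<beta> * \<xi> \<omega>)))"
      "H z = (\<integral>\<omega>. K (z + \<i> * complex_of_real (sqrt \<beta> * \<xi> \<omega>)) \<partial>M)"
      by (simp_all add: HK mult.assoc)
  qed (use smooth ext in blast)+
qed

end
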